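(* Let $G$ be a connected graph with $V(G)=[n]$. Then the following hold: (a) Let $G$ be a labeled Hamiltonian graph. Then $I_G$ is a radical ideal if and only if $G=K_n$. (b) Let $G$ be a labeled semi-Hamiltonian graph. Then $I_G$ is a radical ideal if and only if $G=K_n-e$ where $e=\{1,n\}$.
   Context: All graphs are finite and simple. Let $\mathbb{K}$ be a field, $[n]=\{1,\ldots,n\}$ and $S=\mathbb{K}[x_1,\ldots,x_{n+1}]$. For $1\le i<j\le n$ put $g_{ij}=x_ix_{j+1}-x_jx_{i+1}$. For a graph $G$ with vertex set $[n]$, the Hankel edge ideal $I_G\subset S$ is the ideal generated by the $g_{ij}$ with $i<j$ and $\{i,j\}\in E(G)$. $L_n$ is the path with vertex set $[n]$ and edges $\{i,i+1\}$, $1\le i\le n-1$. $C_n$ is the cycle with vertex set $[n]$ and edges $\{1,n\}$ and $\{i,i+1\}$, $1\le i\le n-1$ (a cycle has at least $3$ vertices). A graph $G$ on $[n]$ is a labeled Hamiltonian graph if $C_n$ is a subgraph of $G$; it is a labeled semi-Hamiltonian graph if $L_n$ is a subgraph of $G$ and $\{1,n\}\notin E(G)$. $K_n$ is the complete graph on $[n]$, and $G-e$ denotes the graph with the same vertex set as $G$ obtained by removing the edge $e$. *)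

theory Defs
  imports
    "HOL-Library.Poly_Mapping"
    "HOL-Algebra.Ideal"
    "Graph_Theory.Digraph_Component"
begin

section \<open>Polynomial rings\<close>

text \<open>
  A monomial is a finitely supported exponent function on variable indices, and a polynomial is a
  finitely supported function from monomials to coefficients; the type class instances of
  \<^typ>\<open>'a \<Rightarrow>\<^sub>0 'b\<close> make multiplication the usual product of polynomials.
\<close>

type_synonym 'k mpoly = "(nat \<Rightarrow>\<^sub>0 nat) \<Rightarrow>\<^sub>0 'k"

definition mpoly_var :: "nat \<Rightarrow> 'k::field mpoly" where
  "mpoly_var i = Poly_Mapping.single (Poly_Mapping.single i 1) 1"

text \<open>The type has a variable for every natural number; the carrier keeps those with index in V.\<close>

definition mpoly_ring :: "nat set \<Rightarrow> 'k::field mpoly ring" where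
  "mpoly_ring V =
    \<lparr> carrier = {p. \<forall>m \<in> Poly_Mapping.keys p. Poly_Mapping.keys m \<subseteq> V},
      monoid.mult = (*), one = 1, zero = 0, add = (+) \<rparr>"

lemma cring_mpoly_ring: "cring (mpoly_ring V :: 'k::field mpoly ring)"
proof -
  have plus: "Poly_Mapping.keys m \<subseteq> V"
    if "\<forall>m\<in>Poly_Mapping.keys p. Poly_Mapping.keys m \<subseteq> V"
      "\<forall>m\<in>Poly_Mapping.keys q. Poly_Mapping.keys m \<subseteq> V" "m \<in> Poly_Mapping.keys (p + q)"
    for p q :: "'k mpoly" and m
    using that keys_add[of p q] by blast
  have times: "Poly_Mapping.keys m \<subseteq> V"
    if p: "\<forall>m\<in>Poly_Mapping.keys p. Poly_Mapping.keys m \<subseteq> V"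
      and q: "\<forall>m\<in>Poly_Mapping.keys q. Poly_Mapping.keys m \<subseteq> V"
      and m: "m \<in> Poly_Mapping.keys (p * q)"
    for p q :: "'k mpoly" and m
  proof -
    obtain a b where "m = a + b" "a \<in> Poly_Mapping.keys p" "b \<in> Poly_Mapping.keys q"
      using m keys_mult[of p q] by blast
    then show ?thesis using p q keys_add[of a b] by blast
  qed
  show ?thesis
  proof (rule cringI)
    show "abelian_group (mpoly_ring V :: 'k mpoly ring)"
    proof (rule abelian_groupI)
      fix x :: "'k mpoly" assume "x \<in> carrier (mpoly_ring V)"
      then have "- x \<in> carrier (mpoly_ring V)"
        by (simp add: mpoly_ring_def)
      then show "\<exists>y\<in>carrier (mpoly_ring V). y \<oplus>\<^bsub>mpoly_ring V\<^esub> x = \<zero>\<^bsub>mpoly_ring V\<^esub>"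
        by (intro bexI[of _ "- x"]) (simp_all add: mpoly_ring_def)
    qed (auto simp: mpoly_ring_def algebra_simps dest: plus)
    show "Group.comm_monoid (mpoly_ring V :: 'k mpoly ring)"
      by (rule comm_monoidI) (auto simp: mpoly_ring_def algebra_simps dest: times)
  qed (auto simp: mpoly_ring_def algebra_simps)
qed

section \<open>Radical ideals\<close>

definition ideal_radical :: "('a, 'b) ring_scheme \<Rightarrow> 'a set \<Rightarrow> 'a set" where
  "ideal_radical R I = {f \<in> carrier R. \<exists>m::nat. m > 0 \<and> f [^]\<^bsub>R\<^esub> m \<in> I}"

definition radical_ideal :: "('a, 'b) ring_scheme \<Rightarrow> 'a set \<Rightarrow> bool" where
  "radical_ideal R I \<longleftrightarrow> ideal I R \<and> ideal_radical R I = I"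

section \<open>Labeled graphs\<close>

text \<open>
  A finite simple graph is a \<^const>\<open>pair_graph\<close>: a finite loop-free symmetric digraph
  without parallel arcs, in which the edge between u and v is the pair of arcs (u,v) and (v,u).
\<close>

definition path_graph :: "nat \<Rightarrow> nat pair_pre_digraph" where
  "path_graph n =
    \<lparr> pverts = {1..n},
      parcs = (\<Union>i \<in> {i. 1 \<le> i \<and> i + 1 \<le> n}. {(i, i + 1), (i + 1, i)}) \<rparr>"

text \<open>For n less than 3 this is not a cycle (for n = 1 it even has a loop).\<close>

definition cycle_graph :: "nat \<Rightarrow> nat pair_pre_digraph" where
  "cycle_graph n =
    \<lparr> pverts = {1..n}, parcs = parcs (path_graph n) \<union> {(1, n), (n, 1)} \<rparr>"

definition complete_graph :: "nat \<Rightarrow> nat pair_pre_digraph" where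
  "complete_graph n =
    \<lparr> pverts = {1..n}, parcs = {(i, j). i \<in> {1..n} \<and> j \<in> {1..n} \<and> i \<noteq> j} \<rparr>"

definition delete_edge :: "'a pair_pre_digraph \<Rightarrow> 'a \<Rightarrow> 'a \<Rightarrow> 'a pair_pre_digraph" where
  "delete_edge G u v = G\<lparr> parcs := parcs G - {(u, v), (v, u)} \<rparr>"

definition labeled_hamiltonian :: "nat \<Rightarrow> nat pair_pre_digraph \<Rightarrow> bool" where
  "labeled_hamiltonian n G \<longleftrightarrow>
    3 \<le> n \<and> subgraph (with_proj (cycle_graph n)) (with_proj G)"

definition labeled_semi_hamiltonian :: "nat \<Rightarrow> nat pair_pre_digraph \<Rightarrow> bool" where
  "labeled_semi_hamiltonian n G \<longleftrightarrow>
    subgraph (with_proj (path_graph n)) (with_proj G) \<and> (1, n) \<notin> parcs G"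

section \<open>Hankel edge ideals\<close>

abbreviation hankel_ring :: "nat \<Rightarrow> 'k::field mpoly ring" where
  "hankel_ring n \<equiv> mpoly_ring {1..n + 1}"

definition hankel_gen :: "nat \<Rightarrow> nat \<Rightarrow> 'k::field mpoly" where
  "hankel_gen i j =
    mpoly_var i * mpoly_var (j + 1) - mpoly_var j * mpoly_var (i + 1)"

definition hankel_edge_ideal :: "nat \<Rightarrow> nat pair_pre_digraph \<Rightarrow> 'k::field mpoly set" where
  "hankel_edge_ideal n G =
    Idl\<^bsub>hankel_ring n\<^esub> {hankel_gen i j | i j. i < j \<and> (i, j) \<in> parcs G}"

end

theory Submission
  imports Defs
begin

text \<open>
  For \<open>K\<^sub>n\<close> the ideal is the kernel of \<open>x\<^sub>i \<mapsto> s t\<^sup>i\<close>, because monomials of equal degree and weight are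
  congruent modulo the generators; as the target is a domain, the ideal is radical. For \<open>K\<^sub>n - {1,n}\<close>
  the ideal is the intersection of that kernel with \<open>(x\<^sub>2, \<dots>, x\<^sub>n)\<close>: each \<open>x\<^sub>k\<close> with \<open>2 \<le> k \<le> n\<close>
  multiplies \<open>g\<^sub>1\<^sub>n\<close> into the ideal, while \<open>g\<^sub>1\<^sub>n\<close> is not in the prime \<open>(x\<^sub>2, \<dots>, x\<^sub>n)\<close>.

  Conversely, let \<open>I\<close> be radical and contain the consecutive minors. By induction on \<open>j - i\<close>, the
  relation \<open>x\<^sub>i\<^sub>+\<^sub>1 g\<^sub>i\<^sub>j = x\<^sub>i g\<^sub>i\<^sub>+\<^sub>1\<^sub>,\<^sub>j + x\<^sub>j g\<^sub>i\<^sub>,\<^sub>i\<^sub>+\<^sub>1\<close> puts \<open>x\<^sub>i\<^sub>+\<^sub>1 g\<^sub>i\<^sub>j\<close> into \<open>I\<close>, and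
  \<open>x\<^sub>k\<^sup>2 \<equiv> x\<^sub>k\<^sub>-\<^sub>1 x\<^sub>k\<^sub>+\<^sub>1\<close> propagates this to all \<open>x\<^sub>k g\<^sub>i\<^sub>j\<close> with \<open>2 \<le> k \<le> n\<close>. Unless \<open>(i,j) = (1,n)\<close>, both
  terms of \<open>g\<^sub>i\<^sub>j\<close> contain such a variable, so \<open>g\<^sub>i\<^sub>j\<^sup>2 \<in> I\<close> and \<open>g\<^sub>i\<^sub>j \<in> I\<close>. Finally, a generator lies in
  \<open>I\<^sub>G\<close> only if it belongs to an edge, by linear independence of the generators in degree 2.
\<close>

section \<open>Arithmetic in polynomial rings and their ideals\<close>

lemma carrier_mpoly_ring_iff:
  "p \<in> carrier (mpoly_ring V) \<longleftrightarrow> (\<forall>m\<in>Poly_Mapping.keys p. Poly_Mapping.keys m \<subseteq> V)"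
  by (simp add: mpoly_ring_def)

lemma mpoly_ring_simps [simp]:
  "a \<otimes>\<^bsub>mpoly_ring V\<^esub> b = a * b"
  "a \<oplus>\<^bsub>mpoly_ring V\<^esub> b = a + b"
  "\<one>\<^bsub>mpoly_ring V\<^esub> = 1"
  "\<zero>\<^bsub>mpoly_ring V\<^esub> = 0"
  by (simp_all add: mpoly_ring_def)

lemma mpoly_ring_pow [simp]: "a [^]\<^bsub>mpoly_ring V\<^esub> (m::nat) = a ^ m"
  by (induction m) (simp_all add: nat_pow_def mult.commute)

lemma carrier_mpoly_ring_closed:
  fixes p q :: "'k::field mpoly"
  shows "0 \<in> carrier (mpoly_ring V :: 'k mpoly ring)"
    and "1 \<in> carrier (mpoly_ring V :: 'k mpoly ring)"
    and "p \<in> carrier (mpoly_ring V) \<Longrightarrow> q \<in> carrier (mpoly_ring V) \<Longrightarrow> p + q \<in> carrier (mpoly_ring V)"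
    and "p \<in> carrier (mpoly_ring V) \<Longrightarrow> q \<in> carrier (mpoly_ring V) \<Longrightarrow> p * q \<in> carrier (mpoly_ring V)"
    and "p \<in> carrier (mpoly_ring V) \<Longrightarrow> - p \<in> carrier (mpoly_ring V)"
    and "p \<in> carrier (mpoly_ring V) \<Longrightarrow> q \<in> carrier (mpoly_ring V) \<Longrightarrow> p - q \<in> carrier (mpoly_ring V)"
proof -
  interpret cring "mpoly_ring V :: 'k mpoly ring" by (rule cring_mpoly_ring)
  show "0 \<in> carrier (mpoly_ring V :: 'k mpoly ring)" using zero_closed by simp
  show "1 \<in> carrier (mpoly_ring V :: 'k mpoly ring)" using one_closed by simp
  show add: "p + q \<in> carrier (mpoly_ring V)"
    if "p \<in> carrier (mpoly_ring V)" "q \<in> carrier (mpoly_ring V)" for p q :: "'k mpoly"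
    using a_closed[OF that] by simp
  show "p * q \<in> carrier (mpoly_ring V)"
    if "p \<in> carrier (mpoly_ring V)" "q \<in> carrier (mpoly_ring V)"
    using m_closed[OF that] by simp
  show uminus: "- p \<in> carrier (mpoly_ring V)" if "p \<in> carrier (mpoly_ring V)" for p :: "'k mpoly"
    using that by (simp add: carrier_mpoly_ring_iff)
  show "p - q \<in> carrier (mpoly_ring V)"
    if "p \<in> carrier (mpoly_ring V)" "q \<in> carrier (mpoly_ring V)"
    using add[OF that(1) uminus[OF that(2)]] by simp
qed

lemma single_in_carrier: "Poly_Mapping.keys m \<subseteq> V \<Longrightarrow> Poly_Mapping.single m c \<in> carrier (mpoly_ring V)"
  by (simp add: carrier_mpoly_ring_iff)

lemma mpoly_var_in_carrier: "i \<in> V \<Longrightarrow> mpoly_var i \<in> carrier (mpoly_ring V)"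
  unfolding mpoly_var_def by (rule single_in_carrier) simp

lemma hankel_gen_in_carrier:
  assumes "(i, j) \<in> {1..n} \<times> {1..n}"
  shows "hankel_gen i j \<in> carrier (hankel_ring n)"
  using assms unfolding hankel_gen_def
  by (intro carrier_mpoly_ring_closed mpoly_var_in_carrier) auto

text \<open>Closure under negation is multiplication by \<open>- 1\<close>, so it needs no condition
  of its own.\<close>

lemma ideal_mpoly_ringI:
  fixes I :: "'k::field mpoly set"
  assumes "I \<subseteq> carrier (mpoly_ring V)" "0 \<in> I"
    and "\<And>p q. p \<in> I \<Longrightarrow> q \<in> I \<Longrightarrow> p + q \<in> I"
    and mult: "\<And>a p. a \<in> carrier (mpoly_ring V) \<Longrightarrow> p \<in> I \<Longrightarrow> a * p \<in> I"
  shows "ideal I (mpoly_ring V)"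
proof -
  interpret cring "mpoly_ring V :: 'k mpoly ring" by (rule cring_mpoly_ring)
  show ?thesis
  proof (rule idealI)
    show "subgroup I (add_monoid (mpoly_ring V))"
    proof (rule add.subgroupI)
      fix p assume "p \<in> I"
      moreover have "\<ominus>\<^bsub>mpoly_ring V\<^esub> p = (- 1) * p"
        using \<open>p \<in> I\<close> assms(1) carrier_mpoly_ring_closed(5)[of p V]
        by (intro minus_equality) auto
      moreover have "- 1 \<in> carrier (mpoly_ring V :: 'k mpoly ring)"
        by (intro carrier_mpoly_ring_closed)
      ultimately show "\<ominus>\<^bsub>mpoly_ring V\<^esub> p \<in> I" using mult by metis
    qed (use assms in auto)
  next
    fix a x :: "'k mpoly" assume "a \<in> I" "x \<in> carrier (mpoly_ring V)"
    then show "x \<otimes>\<^bsub>mpoly_ring V\<^esub> a \<in> I" "a \<otimes>\<^bsub>mpoly_ring V\<^esub> x \<in> I"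
      using mult[of x a] by (simp_all add: mult.commute)
  qed (rule ring_axioms)
qed

context
  fixes V :: "nat set" and I :: "'k::field mpoly set"
  assumes I: "ideal I (mpoly_ring V)"
begin

interpretation ideal I "mpoly_ring V" by (rule I)

lemma ideal_mpoly_carrier: "p \<in> I \<Longrightarrow> p \<in> carrier (mpoly_ring V)"
  by (rule a_Hcarr)

lemma ideal_mpoly_0: "0 \<in> I"
  using additive_subgroup.zero_closed[OF additive_subgroup_axioms] by simp

lemma ideal_mpoly_add: "p \<in> I \<Longrightarrow> q \<in> I \<Longrightarrow> p + q \<in> I"
  using additive_subgroup.a_closed[OF additive_subgroup_axioms] by simp

lemma ideal_mpoly_mult: "a \<in> carrier (mpoly_ring V) \<Longrightarrow> p \<in> I \<Longrightarrow> a * p \<in> I"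
  using I_l_closed[of p a] by simp

lemma ideal_mpoly_uminus: "p \<in> I \<Longrightarrow> - p \<in> I"
  using ideal_mpoly_mult[of "- 1" p] carrier_mpoly_ring_closed(2,5) by fastforce

lemma ideal_mpoly_diff: "p \<in> I \<Longrightarrow> q \<in> I \<Longrightarrow> p - q \<in> I"
  using ideal_mpoly_add[of p "- q"] ideal_mpoly_uminus by simp

lemma ideal_mpoly_sum: "(\<And>x. x \<in> A \<Longrightarrow> f x \<in> I) \<Longrightarrow> sum f A \<in> I"
  by (induction A rule: infinite_finite_induct) (auto intro: ideal_mpoly_0 ideal_mpoly_add)

end

lemma radical_ideal_mpolyD:
  assumes "radical_ideal (mpoly_ring V) I" "f \<in> carrier (mpoly_ring V)" "f ^ m \<in> I" "0 < m"
  shows "f \<in> I"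
  using assms unfolding radical_ideal_def ideal_radical_def by auto

lemma radical_ideal_mpolyI:
  fixes I :: "'k::field mpoly set"
  assumes I: "ideal I (mpoly_ring V)"
    and "\<And>f m. f \<in> carrier (mpoly_ring V) \<Longrightarrow> f ^ m \<in> I \<Longrightarrow> 0 < m \<Longrightarrow> f \<in> I"
  shows "radical_ideal (mpoly_ring V) I"
proof -
  have "f \<in> ideal_radical (mpoly_ring V) I" if "f \<in> I" for f
    unfolding ideal_radical_def
    using that ideal_mpoly_carrier[OF I that] by (auto intro!: exI[of _ 1])
  then show ?thesis
    using assms unfolding radical_ideal_def by (auto simp: ideal_radical_def)
qed

section \<open>Linear extensions of maps on monomials\<close>

text \<open>\<open>Poly_Mapping.single 0 c\<close> is the constant polynomial \<open>c\<close>, so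
  scalars act by ordinary multiplication. If \<open>h\<close> is multiplicative with
  \<open>h 0 = 1\<close>, this is a ring homomorphism; both substitutions used below arise in this
  way.\<close>

definition lin_ext :: "((nat \<Rightarrow>\<^sub>0 nat) \<Rightarrow> 'k::field mpoly) \<Rightarrow> 'k mpoly \<Rightarrow> 'k mpoly" where
  "lin_ext h p = (\<Sum>m\<in>Poly_Mapping.keys p. Poly_Mapping.single 0 (Poly_Mapping.lookup p m) * h m)"

lemma lin_ext_superset:
  assumes "finite A" "Poly_Mapping.keys p \<subseteq> A"
  shows "lin_ext h p = (\<Sum>m\<in>A. Poly_Mapping.single 0 (Poly_Mapping.lookup p m) * h m)"
  unfolding lin_ext_def using assms
  by (intro sum.mono_neutral_left) (auto simp: in_keys_iff)

lemma lin_ext_0 [simp]: "lin_ext h 0 = 0"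
  by (simp add: lin_ext_def)

lemma lin_ext_single: "lin_ext h (Poly_Mapping.single m c) = Poly_Mapping.single 0 c * h m"
  by (subst lin_ext_superset[of "{m}"]) auto

lemma lin_ext_add: "lin_ext h (p + q) = lin_ext h p + lin_ext h q"
proof -
  let ?A = "Poly_Mapping.keys p \<union> Poly_Mapping.keys q"
  have "lin_ext h r = (\<Sum>m\<in>?A. Poly_Mapping.single 0 (Poly_Mapping.lookup r m) * h m)"
    if "Poly_Mapping.keys r \<subseteq> ?A" for r
    using that by (intro lin_ext_superset) auto
  then show ?thesis
    using keys_add[of p q]
    by (simp add: lookup_add single_add distrib_right sum.distrib)
qed

lemma lin_ext_uminus: "lin_ext h (- p) = - lin_ext h p"
  using lin_ext_add[of h p "- p"] by (simp add: eq_neg_iff_add_eq_0 add.commute)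

lemma lin_ext_diff: "lin_ext h (p - q) = lin_ext h p - lin_ext h q"
  using lin_ext_add[of h p "- q"] by (simp add: lin_ext_uminus)

lemma lin_ext_sum: "lin_ext h (sum f A) = (\<Sum>x\<in>A. lin_ext h (f x))"
  by (induction A rule: infinite_finite_induct) (auto simp: lin_ext_add)

lemma mpoly_expand:
  "(p :: 'k::field mpoly) = (\<Sum>m\<in>Poly_Mapping.keys p. Poly_Mapping.single m (Poly_Mapping.lookup p m))"
  by (rule poly_mapping_eqI) (auto simp: lookup_sum lookup_single when_def in_keys_iff)

lemma lin_ext_mult:
  assumes h: "\<And>a b. h (a + b) = h a * h b"
  shows "lin_ext h (p * q) = lin_ext h p * lin_ext h q"
proof -
  have "p * q = (\<Sum>a\<in>Poly_Mapping.keys p. \<Sum>b\<in>Poly_Mapping.keys q.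
      Poly_Mapping.single (a + b) (Poly_Mapping.lookup p a * Poly_Mapping.lookup q b))"
    by (subst mpoly_expand[of p], subst mpoly_expand[of q]) (simp add: sum_product mult_single)
  then have "lin_ext h (p * q) = (\<Sum>a\<in>Poly_Mapping.keys p. \<Sum>b\<in>Poly_Mapping.keys q.
      Poly_Mapping.single 0 (Poly_Mapping.lookup p a * Poly_Mapping.lookup q b) * h (a + b))"
    by (simp add: lin_ext_sum lin_ext_single)
  also have "\<dots> = (\<Sum>a\<in>Poly_Mapping.keys p. \<Sum>b\<in>Poly_Mapping.keys q.
      (Poly_Mapping.single 0 (Poly_Mapping.lookup p a) * h a) *
      (Poly_Mapping.single 0 (Poly_Mapping.lookup q b) * h b))"
  proof (intro sum.cong refl)
    fix a b
    have "(Poly_Mapping.single 0 (Poly_Mapping.lookup p a * Poly_Mapping.lookup q b) :: 'a mpoly)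
      = Poly_Mapping.single 0 (Poly_Mapping.lookup p a) * Poly_Mapping.single 0 (Poly_Mapping.lookup q b)"
      by (simp add: mult_single)
    then show "Poly_Mapping.single 0 (Poly_Mapping.lookup p a * Poly_Mapping.lookup q b) * h (a + b) =
      (Poly_Mapping.single 0 (Poly_Mapping.lookup p a) * h a) *
      (Poly_Mapping.single 0 (Poly_Mapping.lookup q b) * h b)"
      by (simp only: h mult_ac)
  qed
  also have "\<dots> = lin_ext h p * lin_ext h q"
    by (simp add: lin_ext_def sum_product)
  finally show ?thesis .
qed

lemma lin_ext_power:
  assumes "\<And>a b. h (a + b) = h a * h b" "h 0 = 1"
  shows "lin_ext h (p ^ m) = lin_ext h p ^ m"
proof (induction m)
  case 0
  have "lin_ext h (Poly_Mapping.single 0 1) = 1"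
    by (simp only: lin_ext_single assms(2) mult_1_right) simp
  then show ?case by simp
qed (simp add: lin_ext_mult[OF assms(1)])

text \<open>Distinct monomials may have the same image under \<open>h\<close>. A map that depends on
  \<open>m\<close> only through \<open>h m\<close> therefore vanishes on every polynomial killed by
  the extension of \<open>h\<close>.\<close>

lemma lin_ext_lin_ext_single:
  "lin_ext r (lin_ext (\<lambda>m. Poly_Mapping.single (h m) 1) p) = lin_ext (\<lambda>m. r (h m)) p"
proof -
  have "lin_ext (\<lambda>m. Poly_Mapping.single (h m) 1) p =
      (\<Sum>m\<in>Poly_Mapping.keys p. Poly_Mapping.single (h m) (Poly_Mapping.lookup p m))"
    by (simp add: lin_ext_def mult_single)
  then show ?thesis
    by (simp add: lin_ext_sum lin_ext_single) (simp add: lin_ext_def)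
qed

section \<open>Degree, weight and congruence of monomials\<close>

definition wsum :: "(nat \<Rightarrow> nat) \<Rightarrow> (nat \<Rightarrow>\<^sub>0 nat) \<Rightarrow> nat" where
  "wsum c m = (\<Sum>i\<in>Poly_Mapping.keys m. c i * Poly_Mapping.lookup m i)"

lemma wsum_superset:
  assumes "finite A" "Poly_Mapping.keys p \<subseteq> A"
  shows "wsum c p = (\<Sum>i\<in>A. c i * Poly_Mapping.lookup p i)"
  unfolding wsum_def using assms
  by (intro sum.mono_neutral_left) (auto simp: in_keys_iff)

lemma wsum_0 [simp]: "wsum c 0 = 0"
  by (simp add: wsum_def)

lemma wsum_single [simp]: "wsum c (Poly_Mapping.single i k) = c i * k"
  by (subst wsum_superset[of "{i}"]) auto

lemma wsum_add [simp]: "wsum c (p + q) = wsum c p + wsum c q"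
proof -
  let ?A = "Poly_Mapping.keys p \<union> Poly_Mapping.keys q"
  have "wsum c r = (\<Sum>m\<in>?A. c m * Poly_Mapping.lookup r m)"
    if "Poly_Mapping.keys r \<subseteq> ?A" for r
    using that by (intro wsum_superset) auto
  then show ?thesis
    using keys_add[of p q] by (simp add: lookup_add distrib_left sum.distrib)
qed

lemma wsum_1_eq_0_iff: "wsum (\<lambda>_. 1) m = 0 \<longleftrightarrow> m = 0"
  by (auto simp: wsum_def in_keys_iff intro!: poly_mapping_eqI)

abbreviation total_degree :: "(nat \<Rightarrow>\<^sub>0 nat) \<Rightarrow> nat" where
  "total_degree \<equiv> wsum (\<lambda>_. 1)"

abbreviation weight :: "(nat \<Rightarrow>\<^sub>0 nat) \<Rightarrow> nat" where
  "weight \<equiv> wsum (\<lambda>i. i)"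

lemma keys_add_nat:
  "Poly_Mapping.keys ((a :: nat \<Rightarrow>\<^sub>0 nat) + b) = Poly_Mapping.keys a \<union> Poly_Mapping.keys b"
  by (auto simp: in_keys_iff lookup_add)

lemma monom_split:
  assumes "i \<in> Poly_Mapping.keys (m :: nat \<Rightarrow>\<^sub>0 nat)"
  obtains m0 where "m = m0 + Poly_Mapping.single i 1"
proof
  show "m = (m - Poly_Mapping.single i 1) + Poly_Mapping.single i 1"
    using assms
    by (intro poly_mapping_eqI) (auto simp: lookup_minus lookup_add lookup_single when_def in_keys_iff)
qed

lemma weight_ge:
  assumes "\<And>i. i \<in> Poly_Mapping.keys m \<Longrightarrow> j \<le> i"
  shows "j * total_degree m \<le> weight m"
  unfolding wsum_def sum_distrib_left using assms by (intro sum_mono) auto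

lemma weight_less:
  assumes "\<And>i. i \<in> Poly_Mapping.keys m \<Longrightarrow> i \<le> j" "i \<in> Poly_Mapping.keys m" "i < j"
  shows "weight m < j * total_degree m"
  unfolding wsum_def sum_distrib_left using assms
  by (intro sum_strict_mono_ex1) (auto intro!: bexI[of _ i] simp: in_keys_iff)

context
  fixes n :: nat and I :: "'k::field mpoly set"
  assumes I: "ideal I (hankel_ring n)"
    and gen: "\<And>i j. 1 \<le> i \<Longrightarrow> i < j \<Longrightarrow> j \<le> n \<Longrightarrow> hankel_gen i j \<in> I"
begin

text \<open>Moving both indices inwards by one costs one generator: the step from \<open>t\<close>
  to \<open>Suc t\<close> is \<open>hankel_gen (a + t) (b - Suc t)\<close>, whose indices are in
  increasing order because \<open>a + 2 * Suc t \<le> b\<close>.\<close>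

lemma var_prod_congruent_shift:
  assumes "1 \<le> a" "b \<le> n + 1" "a + 2 * t \<le> b"
  shows "mpoly_var a * mpoly_var b - mpoly_var (a + t) * mpoly_var (b - t) \<in> I"
  using assms(3)
proof (induction t)
  case 0
  then show ?case using ideal_mpoly_0[OF I] by simp
next
  case (Suc t)
  have "hankel_gen (a + t) (b - Suc t) \<in> I"
    using Suc.prems assms by (intro gen) auto
  moreover have "b - Suc t + 1 = b - t" using Suc.prems by simp
  ultimately have "mpoly_var (a + t) * mpoly_var (b - t)
      - mpoly_var (a + Suc t) * mpoly_var (b - Suc t) \<in> I"
    by (simp add: hankel_gen_def mult.commute)
  moreover have "mpoly_var a * mpoly_var b - mpoly_var (a + t) * mpoly_var (b - t) \<in> I"
    using Suc by simp
  ultimately have "(mpoly_var a * mpoly_var b - mpoly_var (a + t) * mpoly_var (b - t)) +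
     (mpoly_var (a + t) * mpoly_var (b - t) - mpoly_var (a + Suc t) * mpoly_var (b - Suc t)) \<in> I"
    by (intro ideal_mpoly_add[OF I])
  then show ?case by (simp only: diff_add_cancel add_diff_eq)
qed

lemma var_prod_congruent:
  assumes "1 \<le> a" "b \<le> n + 1" "a \<le> c" "c \<le> b" "c + d = a + b"
  shows "mpoly_var a * mpoly_var b - mpoly_var c * mpoly_var d \<in> I"
proof (cases "c \<le> d")
  case True
  then have "c = a + (c - a)" "d = b - (c - a)" "a + 2 * (c - a) \<le> b"
    using assms by auto
  then show ?thesis
    using var_prod_congruent_shift[of a b "c - a"] assms by metis
next
  case False
  then have "d = a + (d - a)" "c = b - (d - a)" "a + 2 * (d - a) \<le> b"
    using assms by auto
  then show ?thesis
    using var_prod_congruent_shift[of a b "d - a"] assms by (metis mult.commute)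
qed

abbreviation (input) congruent_monom :: "(nat \<Rightarrow>\<^sub>0 nat) \<Rightarrow> (nat \<Rightarrow>\<^sub>0 nat) \<Rightarrow> bool" where
  "congruent_monom a b \<equiv>
    (Poly_Mapping.single a 1 :: 'k mpoly) - Poly_Mapping.single b 1 \<in> I"

lemma congruent_monom_add:
  assumes "congruent_monom a b" "Poly_Mapping.keys c \<subseteq> {1..n+1}"
  shows "congruent_monom (c + a) (c + b)"
  using ideal_mpoly_mult[OF I single_in_carrier[OF assms(2), of 1] assms(1)]
  by (simp add: right_diff_distrib mult_single)

lemma congruent_monom_trans: "congruent_monom a b \<Longrightarrow> congruent_monom b c \<Longrightarrow> congruent_monom a c"
  using ideal_mpoly_add[OF I] by fastforce

lemma congruent_monom_sym: "congruent_monom a b \<Longrightarrow> congruent_monom b a"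
  using ideal_mpoly_uminus[OF I] by fastforce

text \<open>
  The smallest variable of \<open>b\<close> is introduced into \<open>a\<close> by a move \<open>x\<^sub>i x\<^sub>k \<mapsto> x\<^sub>j x\<^sub>i\<^sub>+\<^sub>k\<^sub>-\<^sub>j\<close>,
  which keeps degree and weight; then it cancels.
\<close>

lemma congruent_monom_step:
  assumes IH: "\<And>a b. Poly_Mapping.keys a \<subseteq> {1..n+1} \<Longrightarrow> Poly_Mapping.keys b \<subseteq> {1..n+1} \<Longrightarrow>
      total_degree a = d \<Longrightarrow> total_degree b = d \<Longrightarrow> weight a = weight b \<Longrightarrow> congruent_monom a b"
    and a: "Poly_Mapping.keys a \<subseteq> {1..n+1}" "total_degree a = Suc d"
    and b: "Poly_Mapping.keys b \<subseteq> {1..n+1}" "total_degree b = Suc d"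
    and w: "weight a = weight b"
    and i: "i \<in> Poly_Mapping.keys a" and j: "j \<in> Poly_Mapping.keys b"
    and min: "\<And>k. k \<in> Poly_Mapping.keys b \<Longrightarrow> j \<le> k" and "i \<le> j"
  shows "congruent_monom a b"
proof -
  obtain b0 where b0: "b = b0 + Poly_Mapping.single j 1"
    using monom_split[OF j] .
  have ij: "i \<in> {1..n+1}" "j \<in> {1..n+1}" using a b i j by auto
  \<comment> \<open>Once \<open>x_j\<close> divides the left monomial as well, it cancels from both
    sides and the hypothesis for degree \<open>d\<close> applies.\<close>
  have cancel: "congruent_monom a' b"
    if "a' = a0 + Poly_Mapping.single j 1" "Poly_Mapping.keys a' \<subseteq> {1..n+1}"
      "total_degree a' = Suc d" "weight a' = weight b" for a' a0
  proof -
    have "congruent_monom a0 b0"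
      using that b b0 by (intro IH) (auto simp: keys_add_nat)
    from congruent_monom_add[OF this, of "Poly_Mapping.single j 1"] show ?thesis
      using ij by (simp add: that b0 add.commute)
  qed
  show ?thesis
  proof (cases "i = j")
    case True
    then show ?thesis
      using monom_split[OF i] cancel a w by metis
  next
    case False
    then have "i < j" using \<open>i \<le> j\<close> by simp
    \<comment> \<open>Otherwise all indices in \<open>a\<close> are at most \<open>j\<close> and
      \<open>i\<close> is smaller, so the weight of \<open>a\<close> is below
      \<open>j * Suc d\<close>, whereas that of \<open>b\<close> is at least
      \<open>j * Suc d\<close>.\<close>
    have "\<exists>k\<in>Poly_Mapping.keys a. j < k"
    proof (rule ccontr)
      assume "\<not> ?thesis"
      then have "weight a < j * total_degree a"
        using \<open>i < j\<close> i by (intro weight_less[of _ _ i]) (auto simp: not_less)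
      with weight_ge[of b j] min w a b show False by simp
    qed
    then obtain k where k: "k \<in> Poly_Mapping.keys a" "j < k" by blast
    obtain a1 where a1: "a = a1 + Poly_Mapping.single i 1" using monom_split[OF i] .
    have "k \<in> Poly_Mapping.keys a1"
      using k \<open>i < j\<close> by (auto simp: a1 keys_add_nat)
    then obtain a2 where a2: "a1 = a2 + Poly_Mapping.single k 1" using monom_split by blast
    \<comment> \<open>The factor \<open>x_i * x_k\<close> of \<open>a\<close> is replaced by
      \<open>x_j * x_(i+k-j)\<close>; both products have index sum \<open>i + k\<close>, and
      \<open>i < j < k\<close> keeps the new index in range.\<close>
    define a' where "a' = a2 + (Poly_Mapping.single (i + k - j) 1 + Poly_Mapping.single j 1)"
    have k': "k \<in> {1..n+1}" using k a by auto
    have "mpoly_var i * mpoly_var k - mpoly_var j * mpoly_var (i + k - j) \<in> I"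
      using ij k k' \<open>i < j\<close> by (intro var_prod_congruent) auto
    then have "congruent_monom (Poly_Mapping.single i 1 + Poly_Mapping.single k 1)
        (Poly_Mapping.single j 1 + Poly_Mapping.single (i + k - j) 1)"
      by (simp add: mpoly_var_def mult_single)
    from congruent_monom_add[OF this, of a2] have "congruent_monom a a'"
      using a by (simp add: a1 a2 a'_def keys_add_nat ac_simps)
    moreover have "congruent_monom a' b"
      by (rule cancel[of _ "a2 + Poly_Mapping.single (i + k - j) 1"])
        (use a w k k' ij \<open>i < j\<close> in \<open>auto simp: a'_def a1 a2 keys_add_nat add.assoc\<close>)
    ultimately show ?thesis by (rule congruent_monom_trans)
  qed
qed

lemma congruent_monom_if_same_weight:
  assumes "Poly_Mapping.keys a \<subseteq> {1..n+1}" "Poly_Mapping.keys b \<subseteq> {1..n+1}"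
    "total_degree a = d" "total_degree b = d" "weight a = weight b"
  shows "congruent_monom a b"
  using assms
proof (induction d arbitrary: a b)
  case 0
  then have "a = 0" "b = 0" by (simp_all only: wsum_1_eq_0_iff)
  then show ?case using ideal_mpoly_0[OF I] by simp
next
  case (Suc d)
  let ?i = "Min (Poly_Mapping.keys a)" and ?j = "Min (Poly_Mapping.keys b)"
  have "a \<noteq> 0" "b \<noteq> 0" using Suc.prems by auto
  then have ij: "?i \<in> Poly_Mapping.keys a" "?j \<in> Poly_Mapping.keys b"
    by (auto intro!: Min_in)
  show ?case
  \<comment> \<open>Congruence is symmetric, so the monomial with the smaller least index can take
    the role of \<open>a\<close>.\<close>
  proof (cases "?i \<le> ?j")
    case True
    show ?thesis
      by (rule congruent_monom_step[of d a b ?i ?j]) (use Suc ij True in auto)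
  next
    case False
    have "congruent_monom b a"
      by (rule congruent_monom_step[of d b a ?j ?i]) (use Suc ij False in auto)
    then show ?thesis by (rule congruent_monom_sym)
  qed
qed

end

section \<open>The ideal of the rational normal curve\<close>

definition curve_exponent :: "(nat \<Rightarrow>\<^sub>0 nat) \<Rightarrow> (nat \<Rightarrow>\<^sub>0 nat)" where
  "curve_exponent m = Poly_Mapping.single 0 (total_degree m) + Poly_Mapping.single 1 (weight m)"

text \<open>
  The parametrisation \<open>x\<^sub>i \<mapsto> s t\<^sup>i\<close> of the rational normal curve; the target variables \<open>s\<close>, \<open>t\<close> are
  encoded as \<open>x\<^sub>0\<close>, \<open>x\<^sub>1\<close>, so that the target is again an integral domain.
\<close>

definition curve_hom :: "'k::field mpoly \<Rightarrow> 'k mpoly" where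
  "curve_hom = lin_ext (\<lambda>m. Poly_Mapping.single (curve_exponent m) 1)"

lemma curve_exponent_add: "curve_exponent (a + b) = curve_exponent a + curve_exponent b"
  by (simp add: curve_exponent_def single_add ac_simps)

lemma curve_exponent_eqD:
  assumes "curve_exponent a = curve_exponent b"
  shows "total_degree a = total_degree b" "weight a = weight b"
proof -
  have *: "Poly_Mapping.lookup (curve_exponent c) 0 = total_degree c"
    "Poly_Mapping.lookup (curve_exponent c) 1 = weight c" for c
    by (simp_all add: curve_exponent_def lookup_add lookup_single)
  show "total_degree a = total_degree b" "weight a = weight b"
    using assms *[of a] *[of b] by simp_all
qed

lemma curve_hom_power: "curve_hom (p ^ m) = curve_hom p ^ m"
  unfolding curve_hom_def
  by (rule lin_ext_power) (simp_all add: curve_exponent_add mult_single, simp add: curve_exponent_def)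

lemma curve_hom_hankel_gen: "curve_hom (hankel_gen i j) = 0"
  by (simp add: curve_hom_def hankel_gen_def mpoly_var_def mult_single lin_ext_diff lin_ext_single
      curve_exponent_def add.commute)

text \<open>Replacing each monomial by a chosen representative of its fibre under
  \<open>curve_exponent\<close> factors through \<open>curve_hom\<close> and so kills
  \<open>f\<close>. Hence \<open>f\<close> is a combination of differences between monomials and
  their representatives, and these are congruent modulo \<open>I\<close>.\<close>

lemma ker_curve_hom_subset:
  fixes f :: "'k::field mpoly"
  assumes I: "ideal I (hankel_ring n)"
    and gen: "\<And>i j. 1 \<le> i \<Longrightarrow> i < j \<Longrightarrow> j \<le> n \<Longrightarrow> hankel_gen i j \<in> I"
    and f: "f \<in> carrier (hankel_ring n)" "curve_hom f = 0"
  shows "f \<in> I"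
proof -
  \<comment> \<open>Outside the exponents attained by monomials of the ring the value is arbitrary
    and never evaluated on \<open>f\<close>.\<close>
  define rep where "rep e = (SOME m. Poly_Mapping.keys m \<subseteq> {1..n+1} \<and> curve_exponent m = e)" for e
  have rep: "Poly_Mapping.keys (rep (curve_exponent m)) \<subseteq> {1..n+1}"
      "curve_exponent (rep (curve_exponent m)) = curve_exponent m"
    if "Poly_Mapping.keys m \<subseteq> {1..n+1}" for m
    using someI[of "\<lambda>m'. Poly_Mapping.keys m' \<subseteq> {1..n+1} \<and> curve_exponent m' = curve_exponent m" m] that
    unfolding rep_def by auto
  have "lin_ext (\<lambda>m. Poly_Mapping.single (rep (curve_exponent m)) 1) f = 0"
    using lin_ext_lin_ext_single[of "\<lambda>e. Poly_Mapping.single (rep e) 1" curve_exponent f] f(2)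
    unfolding curve_hom_def by simp
  moreover have "f = lin_ext (\<lambda>m. Poly_Mapping.single m 1) f"
    by (simp add: lin_ext_def mult_single flip: mpoly_expand)
  ultimately have "f = (\<Sum>m\<in>Poly_Mapping.keys f. Poly_Mapping.single 0 (Poly_Mapping.lookup f m) *
      (Poly_Mapping.single m 1 - Poly_Mapping.single (rep (curve_exponent m)) 1))"
    by (simp add: lin_ext_def right_diff_distrib sum_subtractf)
  also have "\<dots> \<in> I"
  proof (intro ideal_mpoly_sum[OF I] ideal_mpoly_mult[OF I] single_in_carrier)
    fix m assume "m \<in> Poly_Mapping.keys f"
    then have m: "Poly_Mapping.keys m \<subseteq> {1..n+1}"
      using f(1) unfolding carrier_mpoly_ring_iff by blast
    note rep[OF m]
    note curve_exponent_eqD[OF this(2)]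
    with rep(1)[OF m] m show "(Poly_Mapping.single m 1 :: 'k mpoly) -
        Poly_Mapping.single (rep (curve_exponent m)) 1 \<in> I"
      by (intro congruent_monom_if_same_weight[OF I gen]) auto
  qed auto
  finally show ?thesis .
qed

text \<open>The third fact is the tool for bounding an edge ideal from above: a property of all its
  elements follows once it cuts out an ideal containing the generators.\<close>

lemma ideal_hankel_edge_ideal:
  assumes "parcs G \<subseteq> {1..n} \<times> {1..n}"
  shows "ideal (hankel_edge_ideal n G :: 'k::field mpoly set) (hankel_ring n)"
    and "i < j \<Longrightarrow> (i, j) \<in> parcs G \<Longrightarrow> hankel_gen i j \<in> (hankel_edge_ideal n G :: 'k mpoly set)"
    and "ideal J (hankel_ring n) \<Longrightarrow>
      (\<And>i j. i < j \<Longrightarrow> (i, j) \<in> parcs G \<Longrightarrow> hankel_gen i j \<in> J) \<Longrightarrow>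
      (hankel_edge_ideal n G :: 'k mpoly set) \<subseteq> J"
proof -
  interpret cring "hankel_ring n :: 'k mpoly ring" by (rule cring_mpoly_ring)
  let ?S = "{hankel_gen i j | i j. i < j \<and> (i, j) \<in> parcs G} :: 'k mpoly set"
  have S: "?S \<subseteq> carrier (hankel_ring n)"
    using hankel_gen_in_carrier assms by blast
  show "ideal (hankel_edge_ideal n G :: 'k mpoly set) (hankel_ring n)"
    unfolding hankel_edge_ideal_def by (rule genideal_ideal[OF S])
  show "hankel_gen i j \<in> (hankel_edge_ideal n G :: 'k mpoly set)"
    if "i < j" "(i, j) \<in> parcs G"
    unfolding hankel_edge_ideal_def using genideal_self[OF S] that by blast
  show "(hankel_edge_ideal n G :: 'k mpoly set) \<subseteq> J"
    if "ideal J (hankel_ring n)" "\<And>i j. i < j \<Longrightarrow> (i, j) \<in> parcs G \<Longrightarrow> hankel_gen i j \<in> J"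
    unfolding hankel_edge_ideal_def by (rule genideal_minimal[OF that(1)]) (use that(2) in blast)
qed

lemma ideal_ker_lin_ext:
  assumes h: "\<And>a b. h (a + b) = h a * h b"
  shows "ideal {f \<in> carrier (mpoly_ring V). lin_ext h f = 0} (mpoly_ring V)"
  by (rule ideal_mpoly_ringI)
    (auto simp: lin_ext_add lin_ext_mult[OF h] intro: carrier_mpoly_ring_closed)

lemma parcs_complete_graph: "parcs (complete_graph n) = {(i, j). i \<in> {1..n} \<and> j \<in> {1..n} \<and> i \<noteq> j}"
  by (simp add: complete_graph_def)

lemma hankel_edge_ideal_subset_ker:
  assumes "parcs G \<subseteq> {1..n} \<times> {1..n}"
    and f: "f \<in> (hankel_edge_ideal n G :: 'k::field mpoly set)"
  shows "curve_hom f = 0"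
proof -
  let ?h = "\<lambda>m. Poly_Mapping.single (curve_exponent m) 1 :: 'k mpoly"
  have "hankel_edge_ideal n G \<subseteq> {f \<in> carrier (hankel_ring n). lin_ext ?h f = 0}"
  proof (rule ideal_hankel_edge_ideal(3)[OF assms(1)])
    show "ideal {f \<in> carrier (hankel_ring n). lin_ext ?h f = 0} (hankel_ring n)"
      by (rule ideal_ker_lin_ext) (simp add: curve_exponent_add mult_single)
    show "hankel_gen i j \<in> {f \<in> carrier (hankel_ring n). lin_ext ?h f = 0}"
      if "i < j" "(i, j) \<in> parcs G" for i j
      using that assms(1) hankel_gen_in_carrier curve_hom_hankel_gen[where ?'a='k, of i j]
      unfolding curve_hom_def by blast
  qed
  then show ?thesis using f unfolding curve_hom_def by blast
qed

lemma complete_graph_bound: "parcs (complete_graph n) \<subseteq> {1..n} \<times> {1..n}"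
  by (auto simp: parcs_complete_graph)

lemma hankel_edge_ideal_complete_iff:
  "f \<in> (hankel_edge_ideal n (complete_graph n) :: 'k::field mpoly set) \<longleftrightarrow>
    f \<in> carrier (hankel_ring n) \<and> curve_hom f = 0"
  using ideal_mpoly_carrier[OF ideal_hankel_edge_ideal(1)[OF complete_graph_bound]]
    hankel_edge_ideal_subset_ker[OF complete_graph_bound]
    ker_curve_hom_subset[OF ideal_hankel_edge_ideal(1,2)[OF complete_graph_bound]]
  by (auto simp: parcs_complete_graph)

text \<open>Membership means vanishing under \<open>curve_hom\<close>, whose values lie in an
  integral domain.\<close>

lemma radical_hankel_edge_ideal_complete:
  "radical_ideal (hankel_ring n) (hankel_edge_ideal n (complete_graph n) :: 'k::field mpoly set)"
proof (rule radical_ideal_mpolyI[OF ideal_hankel_edge_ideal(1)[OF complete_graph_bound]])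
  fix f :: "'k mpoly" and m :: nat
  assume "f \<in> carrier (hankel_ring n)" "f ^ m \<in> hankel_edge_ideal n (complete_graph n)"
  then show "f \<in> hankel_edge_ideal n (complete_graph n)"
    by (simp add: hankel_edge_ideal_complete_iff curve_hom_power)
qed

section \<open>Generators contained in an edge ideal\<close>

lemma single_add_single_eq_iff:
  "Poly_Mapping.single (a::nat) (1::nat) + Poly_Mapping.single b 1 =
    Poly_Mapping.single c 1 + Poly_Mapping.single d 1 \<longleftrightarrow> (a = c \<and> b = d) \<or> (a = d \<and> b = c)"
  (is "?l = ?r \<longleftrightarrow> _")
proof
  assume "?l = ?r"
  then have "Poly_Mapping.keys ?l = Poly_Mapping.keys ?r" by simp
  then show "(a = c \<and> b = d) \<or> (a = d \<and> b = c)"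
    by (simp add: keys_add_nat doubleton_eq_iff) blast
qed (auto simp: add.commute)

lemma lookup_const_mult:
  "Poly_Mapping.lookup (Poly_Mapping.single 0 c * p) m = c * Poly_Mapping.lookup (p :: 'k::field mpoly) m"
  by (subst mult_map_scale_conv_mult[symmetric]) (simp add: Poly_Mapping.map.rep_eq when_def)

text \<open>Without its constant term, \<open>a\<close> contributes only terms of degree at least 3
  to the product.\<close>

lemma degree_2_part_mult:
  fixes a p :: "'k::field mpoly"
  assumes p: "\<And>m. m \<in> Poly_Mapping.keys p \<Longrightarrow> 2 \<le> total_degree m"
    and u: "total_degree u = 2"
  shows "Poly_Mapping.lookup (a * p) u = Poly_Mapping.lookup a 0 * Poly_Mapping.lookup p u"
proof -
  define r where "r = a - Poly_Mapping.single 0 (Poly_Mapping.lookup a 0)"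
  have "Poly_Mapping.lookup r 0 = 0"
    by (simp add: r_def lookup_minus)
  then have r: "0 < total_degree m" if "m \<in> Poly_Mapping.keys r" for m
    using that wsum_1_eq_0_iff[of m] by (metis gr0I in_keys_iff)
  have "u \<notin> Poly_Mapping.keys (r * p)"
  proof
    assume "u \<in> Poly_Mapping.keys (r * p)"
    then obtain b c where "u = b + c" "b \<in> Poly_Mapping.keys r" "c \<in> Poly_Mapping.keys p"
      using keys_mult[of r p] by blast
    with r[of b] p[of c] u show False by simp
  qed
  then have "Poly_Mapping.lookup (r * p) u = 0" by (simp add: in_keys_iff)
  moreover have "a * p = Poly_Mapping.single 0 (Poly_Mapping.lookup a 0) * p + r * p"
    by (simp add: r_def algebra_simps)
  ultimately show ?thesis by (simp add: lookup_add lookup_const_mult)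
qed

text \<open>
  With \<open>u\<^sub>a = x\<^sub>a x\<^sub>i\<^sub>+\<^sub>j\<^sub>+\<^sub>1\<^sub>-\<^sub>a\<close>, a generator \<open>g\<^sub>k\<^sub>l\<close> with \<open>k + l = i + j\<close> is the difference \<open>u\<^sub>k - u\<^sub>k\<^sub>+\<^sub>1\<close>; summing
  the coefficients of \<open>u\<^sub>1, \<dots>, u\<^sub>i\<close> therefore isolates \<open>g\<^sub>i\<^sub>j\<close>.
\<close>

definition pair_coeff_sum :: "nat \<Rightarrow> nat \<Rightarrow> 'k::field mpoly \<Rightarrow> 'k" where
  "pair_coeff_sum i j p =
    (\<Sum>a\<in>{1..i}. Poly_Mapping.lookup p (Poly_Mapping.single a 1 + Poly_Mapping.single (i + j + 1 - a) 1))"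

lemma pair_coeff_sum_hankel_gen:
  assumes "i < j" "1 \<le> k" "k < l"
  shows "pair_coeff_sum i j (hankel_gen k l :: 'k::field mpoly) = (if k = i \<and> l = j then 1 else 0)"
proof -
  have g: "hankel_gen k l =
      Poly_Mapping.single (Poly_Mapping.single k 1 + Poly_Mapping.single (l + 1) 1) (1 :: 'k) -
      Poly_Mapping.single (Poly_Mapping.single (k + 1) 1 + Poly_Mapping.single l 1) 1"
    by (simp add: hankel_gen_def mpoly_var_def mult_single add.commute)
  have "pair_coeff_sum i j (hankel_gen k l :: 'k mpoly) =
      (\<Sum>a\<in>{1..i}. (if a = k \<and> k + l = i + j then 1 else 0) -
         (if a = k + 1 \<and> k + l = i + j then 1 else 0))"
    unfolding pair_coeff_sum_def g
  proof (intro sum.cong refl)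
    fix a assume "a \<in> {1..i}"
    \<comment> \<open>The crossed alternatives are impossible: \<open>a \<le> i < j\<close> makes
      \<open>a\<close> the smaller index of its pair, and \<open>k < l\<close> fixes the order in
      the generator.\<close>
    then have C: "(k = a \<and> l + 1 = i + j + 1 - a) \<or> (k = i + j + 1 - a \<and> l + 1 = a) \<longleftrightarrow> a = k \<and> k + l = i + j"
      and C': "(k + 1 = a \<and> l = i + j + 1 - a) \<or> (k + 1 = i + j + 1 - a \<and> l = a) \<longleftrightarrow> a = k + 1 \<and> k + l = i + j"
      using assms by (simp_all, linarith+)
    show "Poly_Mapping.lookup (Poly_Mapping.single
          (Poly_Mapping.single k (1::nat) + Poly_Mapping.single (l + 1) 1) (1 :: 'k) -
        Poly_Mapping.single (Poly_Mapping.single (k + 1) 1 + Poly_Mapping.single l 1) 1)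
          (Poly_Mapping.single a 1 + Poly_Mapping.single (i + j + 1 - a) 1) =
      (if a = k \<and> k + l = i + j then 1 else 0) - (if a = k + 1 \<and> k + l = i + j then 1 else 0)"
      by (simp only: lookup_minus lookup_single when_def single_add_single_eq_iff C C')
  qed
  also have "\<dots> = (if k = i \<and> l = j then 1 else 0)"
  proof (cases "k + l = i + j")
    \<comment> \<open>The first indicator contributes iff \<open>k \<le> i\<close>, the second iff
      \<open>k + 1 \<le> i\<close>; they cancel except when \<open>k = i\<close>.\<close>
    case True
    then have "l = j \<longleftrightarrow> k = i" by auto
    then show ?thesis
      using True assms by (auto simp: sum_subtractf sum.delta)
  qed auto
  finally show ?thesis .
qed

lemma hankel_gen_in_edge_ideal_imp:
  assumes G: "parcs G \<subseteq> {1..n} \<times> {1..n}" and "i < j"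
    and mem: "hankel_gen i j \<in> (hankel_edge_ideal n G :: 'k::field mpoly set)"
    and "1 \<le> i"
  shows "(i, j) \<in> parcs G"
proof (rule ccontr)
  assume ij: "(i, j) \<notin> parcs G"
  \<comment> \<open>The degree bound makes \<open>J\<close> an ideal: under it, multiplication by
    \<open>a\<close> only scales \<open>pair_coeff_sum\<close> by the constant term of
    \<open>a\<close>. If \<open>(i, j)\<close> is not an edge, \<open>J\<close> contains all
    generators but not \<open>hankel_gen i j\<close>.\<close>
  define J where "J = {p :: 'k mpoly. p \<in> carrier (hankel_ring n) \<and>
    (\<forall>m\<in>Poly_Mapping.keys p. 2 \<le> total_degree m) \<and> pair_coeff_sum i j p = 0}"
  have "hankel_edge_ideal n G \<subseteq> J"
  proof (rule ideal_hankel_edge_ideal(3)[OF G])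
    show "ideal J (hankel_ring n)"
    proof (rule ideal_mpoly_ringI)
      show "J \<subseteq> carrier (hankel_ring n)" by (auto simp: J_def)
      show "0 \<in> J" by (simp add: J_def carrier_mpoly_ring_closed pair_coeff_sum_def)
    next
      fix p q assume "p \<in> J" "q \<in> J"
      then show "p + q \<in> J"
        using keys_add[of p q]
        by (auto simp: J_def pair_coeff_sum_def lookup_add sum.distrib
            intro!: carrier_mpoly_ring_closed)
    next
      fix a p :: "'k mpoly" assume a: "a \<in> carrier (hankel_ring n)" and p: "p \<in> J"
      have "2 \<le> total_degree m" if m: "m \<in> Poly_Mapping.keys (a * p)" for m
      proof -
        obtain b c where "m = b + c" "c \<in> Poly_Mapping.keys p"
          using subsetD[OF keys_mult m] by blast
        then show ?thesis using p by (fastforce simp: J_def)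
      qed
      moreover have "pair_coeff_sum i j (a * p) = Poly_Mapping.lookup a 0 * pair_coeff_sum i j p"
        unfolding pair_coeff_sum_def sum_distrib_left using p
        by (intro sum.cong refl degree_2_part_mult) (auto simp: J_def)
      ultimately show "a * p \<in> J"
        using a p by (auto simp: J_def intro: carrier_mpoly_ring_closed)
    qed
  next
    fix k l assume kl: "k < l" "(k, l) \<in> parcs G"
    then have "(k, l) \<in> {1..n} \<times> {1..n}" using G by blast
    moreover have "2 \<le> total_degree m" if "m \<in> Poly_Mapping.keys (hankel_gen k l :: 'k mpoly)" for m
    proof -
      have "Poly_Mapping.keys (hankel_gen k l :: 'k mpoly) \<subseteq>
         {Poly_Mapping.single k 1 + Poly_Mapping.single (l + 1) 1,
          Poly_Mapping.single l 1 + Poly_Mapping.single (k + 1) 1}"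
        unfolding hankel_gen_def mpoly_var_def mult_single
        by (rule order_trans[OF keys_diff]) auto
      then show ?thesis using that by auto
    qed
    moreover have "pair_coeff_sum i j (hankel_gen k l :: 'k mpoly) = 0"
      using pair_coeff_sum_hankel_gen[OF \<open>i < j\<close>, of k l, where ?'k='k] kl ij calculation(1) by auto
    ultimately show "hankel_gen k l \<in> J"
      unfolding J_def mem_Collect_eq by (intro conjI ballI hankel_gen_in_carrier)
  qed
  then have "pair_coeff_sum i j (hankel_gen i j :: 'k mpoly) = 0"
    using mem by (auto simp: J_def)
  then show False
    using pair_coeff_sum_hankel_gen[of i j i j, where ?'k='k] assms by simp
qed

section \<open>Radical ideals containing the consecutive minors\<close>

context
  fixes n :: nat and I :: "'k::field mpoly set"
  assumes rad: "radical_ideal (hankel_ring n) I"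
    and consecutive: "\<And>i. 1 \<le> i \<Longrightarrow> i + 1 \<le> n \<Longrightarrow> hankel_gen i (i + 1) \<in> I"
begin

private lemma I: "ideal I (hankel_ring n)"
  using rad by (simp add: radical_ideal_def)

text \<open>Since \<open>hankel_gen (k - 1) k\<close> is \<open>x_(k-1) * x_(k+1) - x_k^2\<close>,
  the square of \<open>x_k * q\<close> is congruent to \<open>(x_(k-1) * q) * (x_(k+1) * q)\<close>,
  and one factor lies in \<open>I\<close>.\<close>

lemma var_mult_step:
  assumes q: "q \<in> carrier (hankel_ring n)" and k: "2 \<le> k" "k \<le> n"
    and "mpoly_var (k - 1) * q \<in> I \<or> mpoly_var (k + 1) * q \<in> I"
  shows "mpoly_var k * q \<in> I"
proof (rule radical_ideal_mpolyD[OF rad])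
  have var: "mpoly_var l \<in> carrier (hankel_ring n)" if "l \<in> {1..n+1}" for l
    using mpoly_var_in_carrier that by blast
  have "hankel_gen (k - 1) k \<in> I"
    using consecutive[of "k - 1"] k by simp
  then have "(q * q) * hankel_gen (k - 1) k \<in> I"
    by (intro ideal_mpoly_mult[OF I] carrier_mpoly_ring_closed q)
  moreover have "(mpoly_var (k + 1) * q) * (mpoly_var (k - 1) * q) \<in> I"
    using assms(4)
  proof
    assume "mpoly_var (k - 1) * q \<in> I"
    then show ?thesis
      using k by (intro ideal_mpoly_mult[OF I _ \<open>mpoly_var (k - 1) * q \<in> I\<close>]
          carrier_mpoly_ring_closed var q) auto
  next
    assume "mpoly_var (k + 1) * q \<in> I"
    then have "(mpoly_var (k - 1) * q) * (mpoly_var (k + 1) * q) \<in> I"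
      using k by (intro ideal_mpoly_mult[OF I _ \<open>mpoly_var (k + 1) * q \<in> I\<close>]
          carrier_mpoly_ring_closed var q) auto
    then show ?thesis by (simp only: mult.commute)
  qed
  ultimately have "(mpoly_var (k + 1) * q) * (mpoly_var (k - 1) * q) -
      (q * q) * hankel_gen (k - 1) k \<in> I"
    by (intro ideal_mpoly_diff[OF I])
  also have "(mpoly_var (k + 1) * q) * (mpoly_var (k - 1) * q) -
      (q * q) * hankel_gen (k - 1) k = (mpoly_var k * q) ^ 2"
    using k by (simp add: hankel_gen_def algebra_simps power2_eq_square)
  finally show "(mpoly_var k * q) ^ 2 \<in> I" .
  show "mpoly_var k * q \<in> carrier (hankel_ring n)"
    using k by (intro carrier_mpoly_ring_closed var q) auto
qed simp

lemma var_mult_all: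
  assumes q: "q \<in> carrier (hankel_ring n)" and k: "2 \<le> k" "k \<le> n" and mem: "mpoly_var k * q \<in> I"
    and l: "2 \<le> l" "l \<le> n"
  shows "mpoly_var l * q \<in> I"
proof (cases "k \<le> l")
  case True
  then show ?thesis using l(2)
  proof (induction l rule: dec_induct)
    case (step m)
    then show ?case using var_mult_step[OF q, of "Suc m"] k by simp
  qed (rule mem)
next
  case False
  then have "l \<le> k" by simp
  then show ?thesis using l(1)
  proof (induction l rule: inc_induct)
    case (step m)
    then show ?case using var_mult_step[OF q, of m] k by simp
  qed (rule mem)
qed

lemma hankel_gen_in_radical:
  assumes "1 \<le> i" "i < j" "j \<le> n" "(i, j) \<noteq> (1, n)"
  shows "hankel_gen i j \<in> I"
  using assms
proof (induction "j - i" arbitrary: i j rule: less_induct)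
  case less
  have var: "mpoly_var l \<in> carrier (hankel_ring n)" if "l \<in> {1..n+1}" for l
    using mpoly_var_in_carrier that by blast
  let ?g = "hankel_gen i j :: 'k mpoly"
  have g: "?g \<in> carrier (hankel_ring n)"
    using less.prems by (intro hankel_gen_in_carrier) auto
  show ?case
  proof (cases "j = i + 1")
    case True
    then show ?thesis using consecutive less.prems by simp
  next
    case False
    have "hankel_gen (i + 1) j \<in> I"
      using False less.prems by (intro less.hyps) auto
    moreover have "hankel_gen i (i + 1) \<in> I"
      using False less.prems by (intro consecutive) auto
    ultimately have "mpoly_var i * hankel_gen (i + 1) j + mpoly_var j * hankel_gen i (i + 1) \<in> I"
      using less.prems
      by (intro ideal_mpoly_add[OF I] ideal_mpoly_mult[OF I] var) auto
    also have "mpoly_var i * hankel_gen (i + 1) j + mpoly_var j * hankel_gen i (i + 1) =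
        mpoly_var (i + 1) * ?g"
      by (simp add: hankel_gen_def algebra_simps)
    finally have all: "mpoly_var l * ?g \<in> I" if "2 \<le> l" "l \<le> n" for l
      using var_mult_all[OF g, of "i + 1" l] that less.prems by simp
    \<comment> \<open>Here \<open>(i, j) \<noteq> (1, n)\<close> enters: if \<open>i = 1\<close>,
      then \<open>j + 1 \<le> n\<close> and \<open>x_(j+1)\<close> is an interior variable;
      otherwise \<open>x_i\<close> is one.\<close>
    have "mpoly_var i * mpoly_var (j + 1) * ?g \<in> I"
    proof (cases "i = 1")
      case True
      then have "mpoly_var i * (mpoly_var (j + 1) * ?g) \<in> I"
        using less.prems by (intro ideal_mpoly_mult[OF I] all var) auto
      then show ?thesis by (simp only: mult.assoc)
    next
      case False
      then have "mpoly_var (j + 1) * (mpoly_var i * ?g) \<in> I"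
        using less.prems by (intro ideal_mpoly_mult[OF I] all var) auto
      then show ?thesis by (simp only: mult_ac)
    qed
    moreover have "mpoly_var (i + 1) * (mpoly_var j * ?g) \<in> I"
      using less.prems by (intro ideal_mpoly_mult[OF I] all var) auto
    ultimately have "mpoly_var i * mpoly_var (j + 1) * ?g - mpoly_var (i + 1) * (mpoly_var j * ?g) \<in> I"
      by (rule ideal_mpoly_diff[OF I])
    also have "mpoly_var i * mpoly_var (j + 1) * ?g - mpoly_var (i + 1) * (mpoly_var j * ?g) = ?g ^ 2"
      by (simp add: hankel_gen_def algebra_simps power2_eq_square)
    finally show ?thesis
      by (rule radical_ideal_mpolyD[OF rad g]) simp
  qed
qed

end

section \<open>The complete graph without the edge from 1 to n\<close>

text \<open>The substitution \<open>x\<^sub>2 = \<dots> = x\<^sub>n = 0\<close>.\<close>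

definition kill_interior_hom :: "nat \<Rightarrow> 'k::field mpoly \<Rightarrow> 'k mpoly" where
  "kill_interior_hom n = lin_ext (\<lambda>m. if Poly_Mapping.keys m \<inter> {2..n} = {} then Poly_Mapping.single m 1 else 0)"

lemma kill_interior_hom_mult: "kill_interior_hom n (p * q) = kill_interior_hom n p * kill_interior_hom n q"
  unfolding kill_interior_hom_def
  by (rule lin_ext_mult) (auto simp: keys_add_nat mult_single)

lemma kill_interior_hom_power: "kill_interior_hom n (p ^ m) = kill_interior_hom n p ^ m"
  unfolding kill_interior_hom_def
  by (rule lin_ext_power) (auto simp: keys_add_nat mult_single)

lemma kill_interior_hom_add: "kill_interior_hom n (p + q) = kill_interior_hom n p + kill_interior_hom n q"
  unfolding kill_interior_hom_def by (rule lin_ext_add)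

text \<open>The substitution leaves the coefficients of monomials without interior variables
  unchanged, so no such monomial can occur in an element of its kernel.\<close>

lemma kill_interior_hom_eq_0D:
  assumes "kill_interior_hom n p = 0" "m \<in> Poly_Mapping.keys p"
  shows "Poly_Mapping.keys m \<inter> {2..n} \<noteq> {}"
proof
  assume m: "Poly_Mapping.keys m \<inter> {2..n} = {}"
  have "Poly_Mapping.lookup (kill_interior_hom n p) m =
      (\<Sum>a\<in>Poly_Mapping.keys p. if a = m then Poly_Mapping.lookup p a else 0)"
    unfolding kill_interior_hom_def lin_ext_def lookup_sum
    using m by (intro sum.cong refl) (auto simp: mult_single lookup_single)
  also have "\<dots> = Poly_Mapping.lookup p m"
    using assms(2) by simp
  finally show False using assms by (simp add: in_keys_iff)
qed

lemma parcs_delete_edge_complete: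
  "parcs (delete_edge (complete_graph n) 1 n) =
    {(i, j). i \<in> {1..n} \<and> j \<in> {1..n} \<and> i \<noteq> j} - {(1, n), (n, 1)}"
  by (simp add: delete_edge_def complete_graph_def)

context
  fixes n :: nat and I :: "'k::field mpoly set"
  assumes n: "3 \<le> n" and I: "ideal I (hankel_ring n)"
    and gen: "\<And>i j. 1 \<le> i \<Longrightarrow> i < j \<Longrightarrow> j \<le> n \<Longrightarrow> (i, j) \<noteq> (1, n) \<Longrightarrow> hankel_gen i j \<in> I"
begin

text \<open>For \<open>k < n\<close> this is a three-term relation with
  \<open>hankel_gen k n\<close> and \<open>hankel_gen 1 k\<close>. For \<open>k = n\<close> that
  relation is a tautology, and one with the shifted coefficients \<open>x_2\<close> and
  \<open>x_(n+1)\<close> replaces it.\<close>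

lemma var_mult_hankel_gen_1_n:
  assumes k: "2 \<le> k" "k \<le> n"
  shows "mpoly_var k * hankel_gen 1 n \<in> I"
proof -
  have var: "mpoly_var l \<in> carrier (hankel_ring n)" if "l \<in> {1..n+1}" for l
    using mpoly_var_in_carrier that by blast
  show ?thesis
  proof (cases "k = n")
    case False
    then have "mpoly_var 1 * hankel_gen k n + mpoly_var n * hankel_gen 1 k \<in> I"
      using k by (intro ideal_mpoly_add[OF I] ideal_mpoly_mult[OF I] var gen) auto
    also have "mpoly_var 1 * hankel_gen k n + mpoly_var n * hankel_gen 1 k =
        mpoly_var k * (hankel_gen 1 n :: 'k mpoly)"
      by (simp add: hankel_gen_def algebra_simps)
    finally show ?thesis .
  next
    case True
    then have "mpoly_var 2 * hankel_gen (n - 1) n + mpoly_var (n + 1) * hankel_gen 1 (n - 1) \<in> I"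
      using n by (intro ideal_mpoly_add[OF I] ideal_mpoly_mult[OF I] var gen) auto
    also have "mpoly_var 2 * hankel_gen (n - 1) n + mpoly_var (n + 1) * hankel_gen 1 (n - 1) =
        mpoly_var k * (hankel_gen 1 n :: 'k mpoly)"
      using n True by (simp add: hankel_gen_def algebra_simps numeral_2_eq_2)
    finally show ?thesis .
  qed
qed

lemma mult_hankel_gen_1_n:
  assumes c: "c \<in> carrier (hankel_ring n)" "kill_interior_hom n c = 0"
  shows "c * hankel_gen 1 n \<in> I"
proof -
  have "(\<Sum>m\<in>Poly_Mapping.keys c. Poly_Mapping.single m (Poly_Mapping.lookup c m) * hankel_gen 1 n) \<in> I"
  proof (rule ideal_mpoly_sum[OF I])
    fix m assume m: "m \<in> Poly_Mapping.keys c"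
    then obtain k where k: "k \<in> Poly_Mapping.keys m" "2 \<le> k" "k \<le> n"
      using kill_interior_hom_eq_0D[OF c(2)] by fastforce
    obtain m0 where m0: "m = m0 + Poly_Mapping.single k 1" using monom_split[OF k(1)] .
    let ?c0 = "Poly_Mapping.single m0 (Poly_Mapping.lookup c m)"
    have "Poly_Mapping.keys m \<subseteq> {1..n+1}"
      using c m unfolding carrier_mpoly_ring_iff by blast
    then have "?c0 \<in> carrier (hankel_ring n)"
      by (intro single_in_carrier) (auto simp: m0 keys_add_nat)
    then have "?c0 * (mpoly_var k * hankel_gen 1 n) \<in> I"
      using k by (intro ideal_mpoly_mult[OF I] var_mult_hankel_gen_1_n)
    moreover have "Poly_Mapping.single m (Poly_Mapping.lookup c m) = ?c0 * mpoly_var k"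
      unfolding mpoly_var_def mult_single m0 by simp
    ultimately show "Poly_Mapping.single m (Poly_Mapping.lookup c m) * hankel_gen 1 n \<in> I"
      by (simp only: mult.assoc)
  qed
  then show ?thesis
    by (simp flip: sum_distrib_right mpoly_expand)
qed

end

lemma delete_edge_bound: "parcs (delete_edge (complete_graph n) 1 n) \<subseteq> {1..n} \<times> {1..n}"
  unfolding parcs_delete_edge_complete by auto

text \<open>If a power of \<open>f\<close> lies in the ideal, then \<open>f\<close> lies in the
  ideal of the complete graph, so \<open>f = h + c * hankel_gen 1 n\<close> with \<open>h\<close> in
  the smaller ideal. Setting the interior variables to 0 kills \<open>f\<close> and \<open>h\<close>
  but not \<open>hankel_gen 1 n\<close>. Hence it kills \<open>c\<close>, and
  \<open>c * hankel_gen 1 n\<close> lies in the smaller ideal too.\<close>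

lemma radical_hankel_edge_ideal_delete_edge:
  assumes n: "3 \<le> n"
  shows "radical_ideal (hankel_ring n)
    (hankel_edge_ideal n (delete_edge (complete_graph n) 1 n) :: 'k::field mpoly set)"
    (is "radical_ideal _ ?I")
proof -
  note I = ideal_hankel_edge_ideal(1)[OF delete_edge_bound, where ?'k='k]
  have gen: "hankel_gen i j \<in> ?I"
    if "1 \<le> i" "i < j" "j \<le> n" "(i, j) \<noteq> (1, n)" for i j
    using that
    by (intro ideal_hankel_edge_ideal(2)[OF delete_edge_bound], unfold parcs_delete_edge_complete) auto
  show ?thesis
  proof (rule radical_ideal_mpolyI[OF I])
    fix f :: "'k mpoly" and m :: nat
    assume f: "f \<in> carrier (hankel_ring n)" "f ^ m \<in> ?I"
    have g: "hankel_gen 1 n \<in> carrier (hankel_ring n)"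
      using n by (intro hankel_gen_in_carrier) auto
    \<comment> \<open>Both terms of a generator contain an interior variable, except for the term
      \<open>x_1 * x_(n+1)\<close> of \<open>hankel_gen 1 n\<close>.\<close>
    have hom_gen: "kill_interior_hom n (hankel_gen i j :: 'k mpoly) =
        (if (i, j) = (1, n) then Poly_Mapping.single (Poly_Mapping.single 1 1 + Poly_Mapping.single (n+1) 1) 1 else 0)"
      if "1 \<le> i" "i < j" "j \<le> n" for i j
      using that n unfolding kill_interior_hom_def
      by (auto simp: hankel_gen_def mpoly_var_def mult_single lin_ext_diff lin_ext_single keys_add_nat)
    have "?I \<subseteq> {f \<in> carrier (hankel_ring n). kill_interior_hom n f = 0}"
    proof (rule ideal_hankel_edge_ideal(3)[OF delete_edge_bound])
      show "ideal {f \<in> carrier (hankel_ring n). kill_interior_hom n f = (0 :: 'k mpoly)} (hankel_ring n)"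
        unfolding kill_interior_hom_def
        by (rule ideal_ker_lin_ext) (auto simp: keys_add_nat mult_single)
      fix i j assume ij: "i < j" "(i, j) \<in> parcs (delete_edge (complete_graph n) 1 n)"
      then have "kill_interior_hom n (hankel_gen i j :: 'k mpoly) = 0"
        using hom_gen[of i j] unfolding parcs_delete_edge_complete by auto
      then show "hankel_gen i j \<in> {f \<in> carrier (hankel_ring n). kill_interior_hom n f = (0 :: 'k mpoly)}"
        using ij delete_edge_bound hankel_gen_in_carrier by blast
    qed
    then have hom_I: "kill_interior_hom n h = 0" if "h \<in> ?I" for h
      using that by blast
    have "f \<in> hankel_edge_ideal n (complete_graph n)"
      using f hankel_edge_ideal_subset_ker[OF delete_edge_bound f(2)]
      by (simp add: hankel_edge_ideal_complete_iff curve_hom_power)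
    \<comment> \<open>Restoring the edge adds a single generator, so the larger ideal is contained
      in the sum of the smaller one and the multiples of \<open>hankel_gen 1 n\<close>.\<close>
    moreover have "hankel_edge_ideal n (complete_graph n) \<subseteq>
      {h + c * hankel_gen 1 n | h c. h \<in> ?I \<and> c \<in> carrier (hankel_ring n)}" (is "_ \<subseteq> ?J")
    proof (rule ideal_hankel_edge_ideal(3)[OF complete_graph_bound])
      show "ideal ?J (hankel_ring n)"
      proof (rule ideal_mpoly_ringI)
        show "?J \<subseteq> carrier (hankel_ring n)"
          using ideal_mpoly_carrier[OF I] g carrier_mpoly_ring_closed(3,4) by blast
        have "0 + 0 * hankel_gen 1 n \<in> ?J"
          using ideal_mpoly_0[OF I] carrier_mpoly_ring_closed(1) by blast
        then show "0 \<in> ?J" by simp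
      next
        fix p q assume "p \<in> ?J" "q \<in> ?J"
        then obtain h c h' c' where "p = h + c * hankel_gen 1 n" "q = h' + c' * hankel_gen 1 n"
          "h \<in> ?I" "h' \<in> ?I" "c \<in> carrier (hankel_ring n)" "c' \<in> carrier (hankel_ring n)"
          by blast
        moreover from this have "p + q = (h + h') + (c + c') * hankel_gen 1 n"
          by (simp add: algebra_simps)
        ultimately show "p + q \<in> ?J"
          using ideal_mpoly_add[OF I] carrier_mpoly_ring_closed(3) by blast
      next
        fix a p :: "'k mpoly" assume "a \<in> carrier (hankel_ring n)" "p \<in> ?J"
        then obtain h c where "p = h + c * hankel_gen 1 n" "h \<in> ?I" "c \<in> carrier (hankel_ring n)"
          "a \<in> carrier (hankel_ring n)"
          by blast
        moreover from this have "a * p = a * h + (a * c) * hankel_gen 1 n"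
          by (simp add: algebra_simps)
        ultimately show "a * p \<in> ?J"
          using ideal_mpoly_mult[OF I] carrier_mpoly_ring_closed(4) by blast
      qed
    next
      fix i j assume ij: "i < j" "(i, j) \<in> parcs (complete_graph n)"
      show "hankel_gen i j \<in> ?J"
      proof (cases "(i, j) = (1, n)")
        case True
        have "0 + 1 * hankel_gen 1 n \<in> ?J"
          using ideal_mpoly_0[OF I] carrier_mpoly_ring_closed(2) by blast
        then show ?thesis using True by simp
      next
        case False
        then have "hankel_gen i j \<in> ?I"
          using ij gen by (simp add: parcs_complete_graph)
        then have "hankel_gen i j + 0 * hankel_gen 1 n \<in> ?J"
          using carrier_mpoly_ring_closed(1) by blast
        then show ?thesis by simp
      qed
    qed
    ultimately obtain h c where hc: "f = h + c * hankel_gen 1 n" "h \<in> ?I" "c \<in> carrier (hankel_ring n)"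
      by blast
    have "kill_interior_hom n f ^ m = 0"
      using hom_I[OF f(2)] by (simp add: kill_interior_hom_power)
    then have "kill_interior_hom n c * kill_interior_hom n (hankel_gen 1 n) = 0"
      using hom_I[OF hc(2)] by (simp add: hc(1) kill_interior_hom_add kill_interior_hom_mult)
    moreover have "kill_interior_hom n (hankel_gen 1 n :: 'k mpoly) \<noteq> 0"
    proof -
      have "Poly_Mapping.single u (1 :: 'k) \<noteq> 0" for u :: "nat \<Rightarrow>\<^sub>0 nat"
        by (metis lookup_single_eq lookup_zero zero_neq_one)
      then show ?thesis using hom_gen[of 1 n] n by simp
    qed
    ultimately have "kill_interior_hom n c = 0" by simp
    then have "c * hankel_gen 1 n \<in> ?I"
      using hc(3) by (intro mult_hankel_gen_1_n[OF n I gen]) auto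
    then show "f \<in> ?I"
      unfolding hc(1) using hc(2) by (intro ideal_mpoly_add[OF I])
  qed
qed

section \<open>Labeled Hamiltonian and semi-Hamiltonian graphs\<close>

theorem corollary2p3:
  fixes n :: nat and G :: "nat pair_pre_digraph"
  assumes "pair_graph G"
    and "pverts G = {1..n}"
    and "connected (with_proj G)"
  shows
    "(labeled_hamiltonian n G \<longrightarrow>
       (radical_ideal (hankel_ring n) (hankel_edge_ideal n G :: 'k::field mpoly set)
         \<longleftrightarrow> G = complete_graph n)) \<and>
     (labeled_semi_hamiltonian n G \<longrightarrow>
       (radical_ideal (hankel_ring n) (hankel_edge_ideal n G :: 'k::field mpoly set)
         \<longleftrightarrow> G = delete_edge (complete_graph n) 1 n))"
proof -
  interpret pair_graph G by (rule assms(1))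
  have bound: "parcs G \<subseteq> {1..n} \<times> {1..n}"
    using in_arcsD1 in_arcsD2 assms(2) by auto
  have sym: "(j, i) \<in> parcs G" if "(i, j) \<in> parcs G" for i j
    using pair_sym_arcs that by (auto simp: symmetric_def sym_def)
  have irrefl: "i \<noteq> j" if "(i, j) \<in> parcs G" for i j
    using pair_no_loops[OF that] by simp
  have edges: "(i, j) \<in> parcs G"
    if rad: "radical_ideal (hankel_ring n) (hankel_edge_ideal n G :: 'k mpoly set)"
      and path: "parcs (path_graph n) \<subseteq> parcs G"
      and ij: "i \<in> {1..n}" "j \<in> {1..n}" "i \<noteq> j" "(i, j) \<noteq> (1, n)" "(i, j) \<noteq> (n, 1)" for i j
  proof -
    \<comment> \<open>Generators only see arcs with increasing ends; the reversed arcs come from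
      symmetry of \<open>G\<close>.\<close>
    have *: "(i, j) \<in> parcs G" if "1 \<le> i" "i < j" "j \<le> n" "(i, j) \<noteq> (1, n)" for i j
    proof (rule hankel_gen_in_edge_ideal_imp[OF bound \<open>i < j\<close> _ \<open>1 \<le> i\<close>])
      show "hankel_gen i j \<in> (hankel_edge_ideal n G :: 'k mpoly set)"
      proof (rule hankel_gen_in_radical[OF rad _ that])
        fix i assume "1 \<le> i" "i + 1 \<le> n"
        then have "(i, i + 1) \<in> parcs G"
          using path by (auto simp: path_graph_def)
        then show "hankel_gen i (i + 1) \<in> (hankel_edge_ideal n G :: 'k mpoly set)"
          by (intro ideal_hankel_edge_ideal(2)[OF bound]) auto
      qed
    qed
    show ?thesis
      using *[of i j] *[of j i] sym[of j i] ij by (cases "i < j") auto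
  qed
  have graph_eqI: "G = H" if "pverts H = {1..n}" "parcs G = parcs H" for H
    using that assms(2) by simp
  show ?thesis
  proof (intro conjI impI iffI)
    assume "labeled_hamiltonian n G"
      and rad: "radical_ideal (hankel_ring n) (hankel_edge_ideal n G :: 'k mpoly set)"
    then have cyc: "parcs (path_graph n) \<subseteq> parcs G" "(1, n) \<in> parcs G" "(n, 1) \<in> parcs G"
      by (auto simp: labeled_hamiltonian_def subgraph_def cycle_graph_def)
    show "G = complete_graph n"
    proof (rule graph_eqI)
      show "parcs G = parcs (complete_graph n)"
        using edges[OF rad cyc(1)] cyc bound irrefl unfolding parcs_complete_graph by blast
    qed (simp add: complete_graph_def)
  next
    assume "G = complete_graph n"
    then show "radical_ideal (hankel_ring n) (hankel_edge_ideal n G :: 'k mpoly set)"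
      using radical_hankel_edge_ideal_complete by simp
  next
    assume "labeled_semi_hamiltonian n G"
      and rad: "radical_ideal (hankel_ring n) (hankel_edge_ideal n G :: 'k mpoly set)"
    then have path: "parcs (path_graph n) \<subseteq> parcs G" "(1, n) \<notin> parcs G"
      by (auto simp: labeled_semi_hamiltonian_def subgraph_def)
    show "G = delete_edge (complete_graph n) 1 n"
    proof (rule graph_eqI)
      show "parcs G = parcs (delete_edge (complete_graph n) 1 n)"
        using edges[OF rad path(1)] path(2) sym bound irrefl
        unfolding parcs_delete_edge_complete by blast
    qed (simp add: delete_edge_def complete_graph_def)
  next
    assume semi: "labeled_semi_hamiltonian n G" and G: "G = delete_edge (complete_graph n) 1 n"
    \<comment> \<open>For \<open>n = 2\<close> the path already contains the edge from 1 to
      \<open>n\<close>, which a semi-Hamiltonian graph excludes.\<close>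
    have "n \<noteq> 2"
      using semi by (auto simp: labeled_semi_hamiltonian_def subgraph_def path_graph_def numeral_2_eq_2)
    then consider "n \<le> 1" | "3 \<le> n" by linarith
    then show "radical_ideal (hankel_ring n) (hankel_edge_ideal n G :: 'k mpoly set)"
    proof cases
      \<comment> \<open>With at most one vertex there are no arcs to delete.\<close>
      case 1
      then have "parcs G = parcs (complete_graph n)"
        unfolding G parcs_delete_edge_complete parcs_complete_graph by auto
      then have "G = complete_graph n"
        by (intro graph_eqI) (simp_all add: complete_graph_def)
      then show ?thesis using radical_hankel_edge_ideal_complete by simp
    next
      case 2
      then show ?thesis unfolding G by (rule radical_hankel_edge_ideal_delete_edge)
    qed
  qed
qed

end
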